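(* Let $n\ge 1$. Suppose that for any positive invertible matrix $S_1$ and any normal invertible matrix $N$ in $M_{3n}(\mathbb{C})$ one has $\|S_1\sharp (N^{*}S_1^{-1}N)\|\geq \|N\|$. Then for any positive invertible matrices $A,B,C\in M_n(\mathbb{C})$, $$A\sharp B^{-1}+B\sharp C^{-1}+C\sharp A^{-1}\geq 3I.$$
   Context: $M_k(\mathbb{C})$ is the space of $k\times k$ complex matrices, $\|\cdot\|$ is the operator norm, $I$ is the identity matrix, and $X\ge Y$ means that $X-Y$ is positive semidefinite. "Positive" means positive semidefinite (Hermitian), so a positive invertible matrix is a positive definite one. For positive invertible $X,Y\in M_k(\mathbb{C})$, the geometric mean is $X\sharp Y = X^{1/2}(X^{-1/2}YX^{-1/2})^{1/2}X^{1/2}$. *)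

theory Defs
  imports "HOL-Analysis.Analysis"
begin

text \<open>
  A \<open>k \<times> k\<close> complex matrix has type \<^typ>\<open>complex^'k^'k\<close> with \<open>CARD('k) = k\<close>, so \<open>k \<ge> 1\<close>
  holds automatically. Since \<^typ>\<open>complex^'k\<close> carries the Euclidean norm, the operator norm of
  \<open>A\<close> is the library's \<^term>\<open>onorm ((*v) A)\<close>.
\<close>

definition adjoint_matrix :: "complex^'n^'m \<Rightarrow> complex^'m^'n" where
  "adjoint_matrix A = map_matrix cnj (transpose A)"

definition hermitian_matrix :: "complex^'n^'n \<Rightarrow> bool" where
  "hermitian_matrix A \<longleftrightarrow> adjoint_matrix A = A"

definition normal_matrix :: "complex^'n^'n \<Rightarrow> bool" where
  "normal_matrix A \<longleftrightarrow> A ** adjoint_matrix A = adjoint_matrix A ** A"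

text \<open>
  For Hermitian \<open>A\<close> the form \<open>x\<^sup>* A x\<close> is real, so taking its real part loses nothing.
\<close>

definition psd_matrix :: "complex^'n^'n \<Rightarrow> bool" where
  "psd_matrix A \<longleftrightarrow>
     hermitian_matrix A \<and> (\<forall>x. 0 \<le> Re (\<Sum>i\<in>UNIV. cnj (x $ i) * (A *v x) $ i))"

definition loewner_ge :: "complex^'n^'n \<Rightarrow> complex^'n^'n \<Rightarrow> bool" where
  "loewner_ge X Y \<longleftrightarrow> psd_matrix (X - Y)"

text \<open>
  The positive semidefinite square root; only meaningful for positive semidefinite
  arguments, where existence and uniqueness are the standard theorem.
\<close>

definition psd_sqrt :: "complex^'n^'n \<Rightarrow> complex^'n^'n" where
  "psd_sqrt A = (THE R. psd_matrix R \<and> R ** R = A)"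

definition geometric_mean :: "complex^'n^'n \<Rightarrow> complex^'n^'n \<Rightarrow> complex^'n^'n" where
  "geometric_mean X Y =
     (let R = psd_sqrt X; R' = matrix_inv R
      in R ** psd_sqrt (R' ** Y ** R') ** R)"

end

(* With K positive definite, take S1 = diag(K A_k K) over three blocks A_1 = A, A_2 = B, A_3 = C and let
   N be the cyclic block permutation tensored with K^2, which is normal. The geometric mean in the
   hypothesis is then diag(K G_k K) with G_k = A_k # A_{k+1}^{-1}. For a unit vector x and
   K = x x* + e I, letting e tend to 0 yields max_k <x, G_k x> >= 1. Replacing the A_k by scalar
   multiples rescales the three numbers <x, G_k x> by arbitrary factors of product 1, so their product
   is at least 1, and AM-GM gives that their sum is at least 3. *)
theory Submission
  imports Defs
begin

subsection \<open>Square roots of positive self-adjoint operators\<close>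

text \<open>The hypothesis bounds one number, a norm, while the conclusion compares matrices. The
  sandwich by K bridges this because P G P = <x, G x> P for the projection P onto the line of x, so
  the norm of K G K is nearly <x, G x>. P itself is singular in general, whereas \<open>S1\<close>
  and \<open>N\<close> must be invertible: hence the summand e I. The square in K^2 is what makes
  the blocks of \<open>adjoint_matrix N ** matrix_inv S1 ** N\<close> equal to K^2 (K A K)^-1 K^2 =
  K A^-1 K; both arguments of the mean are then congruences by K, and congruence passes through the
  mean. That compatibility is read off the Riccati equation G X^-1 G = Y, whose unique positive
  solution is the mean of X and Y. On the other side the norm of N is at least 1 because K x = (1 +
  e) x. The inner product at hand on complex vectors is the real part of the hermitian form, so the
  spectral theory is done for real-linear operators.\<close>

definition psd_op :: "('a::real_inner \<Rightarrow> 'a) \<Rightarrow> bool" where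
  "psd_op f \<longleftrightarrow> linear f \<and> (\<forall>x y. f x \<bullet> y = x \<bullet> f y) \<and> (\<forall>x. 0 \<le> x \<bullet> f x)"

text \<open>The first-order condition at a maximum, without derivatives: near 0 a nonzero linear
  term outgrows any quadratic one, for one sign of \<open>t\<close>.\<close>

lemma linear_coeff_zero_if_quadratic_bound:
  fixes c d :: real
  assumes "\<And>t. t * c \<le> t\<^sup>2 * d"
  shows "c = 0"
proof (rule ccontr)
  assume "c \<noteq> 0"
  define t where "t = c / (2 * (\<bar>d\<bar> + 1))"
  have t: "t * (2 * (\<bar>d\<bar> + 1)) = c"
    by (simp add: t_def)
  have "t \<noteq> 0"
    using \<open>c \<noteq> 0\<close> t by auto
  have "t * c = t\<^sup>2 * (2 * (\<bar>d\<bar> + 1))"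
    using t by (metis mult.assoc power2_eq_square)
  moreover have "t\<^sup>2 * (2 * (\<bar>d\<bar> + 1)) > t\<^sup>2 * d"
    using \<open>t \<noteq> 0\<close> by (intro mult_strict_left_mono) auto
  ultimately show False
    using assms[of t] by linarith
qed

text \<open>A maximiser \<open>v\<close> of the quadratic form on the unit sphere of
  \<open>S\<close> is an eigenvector: the residual \<open>w\<close> is orthogonal to
  \<open>v\<close>, and stationarity in the direction \<open>w\<close> forces it to vanish.\<close>

lemma self_adjoint_eigenvector_exists:
  fixes f :: "'a::euclidean_space \<Rightarrow> 'a"
  assumes "linear f" and sym: "\<And>x y. f x \<bullet> y = x \<bullet> f y"
    and S: "subspace S" "f ` S \<subseteq> S" "S \<noteq> {0}"
  obtains v c where "v \<in> S" "norm v = 1" "f v = c *\<^sub>R v"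
proof -
  interpret linear f by fact
  let ?C = "S \<inter> sphere 0 1"
  have "compact ?C"
    using closed_subspace[OF S(1)] by (simp add: closed_Int_compact)
  moreover obtain u where "u \<in> S" "u \<noteq> 0"
    using S subspace_0 by blast
  then have "u /\<^sub>R norm u \<in> ?C"
    using S(1) by (simp add: subspace_scale)
  then have "?C \<noteq> {}"
    by blast
  moreover have "continuous_on ?C (\<lambda>x. x \<bullet> f x)"
    using \<open>linear f\<close> by (intro continuous_intros linear_continuous_on) (simp add: linear_conv_bounded_linear)
  ultimately obtain v where v: "v \<in> ?C" and max: "\<And>y. y \<in> ?C \<Longrightarrow> y \<bullet> f y \<le> v \<bullet> f v"
    using continuous_attains_sup[of ?C] by blast
  define c where "c = v \<bullet> f v"
  have vv: "v \<bullet> v = 1"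
    using v by (simp add: dot_square_norm)
  have bound: "y \<bullet> f y \<le> c * (y \<bullet> y)" if "y \<in> S" for y
  proof (cases "y = 0")
    case False
    then have "y /\<^sub>R norm y \<in> ?C"
      using that S(1) by (simp add: subspace_scale)
    from max[OF this] show ?thesis
      using False by (simp add: c_def scale divide_simps dot_square_norm power2_eq_square)
  qed simp
  define w where "w = f v - c *\<^sub>R v"
  have wS: "w \<in> S"
    using v S by (auto simp: w_def intro!: subspace_diff subspace_scale)
  have vw: "v \<bullet> w = 0"
    by (simp add: w_def inner_diff_right vv c_def)
  \<comment> \<open>This is \<open>bound\<close> at \<open>v + t *\<^sub>R w\<close>: the constant
    terms \<open>c\<close> cancel, and \<open>v \<bullet> w = 0\<close> removes the linear term on
    the right.\<close>
  have "t * (2 * (f v \<bullet> w)) \<le> t\<^sup>2 * (c * (w \<bullet> w) - w \<bullet> f w)" for t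
  proof -
    have "v + t *\<^sub>R w \<in> S"
      using v wS S(1) by (simp add: subspace_add subspace_scale)
    from bound[OF this] show ?thesis
      using vw sym[of v w]
      by (simp add: add scale inner_add_left inner_add_right vv c_def[symmetric] inner_commute
          power2_eq_square algebra_simps)
  qed
  from linear_coeff_zero_if_quadratic_bound[OF this] have "f v \<bullet> w = 0"
    by simp
  then have "w \<bullet> w = 0"
    using vw by (simp add: w_def inner_diff_left inner_diff_right inner_commute)
  then have "f v = c *\<^sub>R v"
    by (simp add: w_def)
  with v show thesis
    by (intro that) auto
qed

text \<open>Stated for invariant subspaces so that induction on the dimension works: by symmetry of
  \<open>f\<close>, the complement in \<open>S\<close> of an eigenvector is again invariant.\<close>

theorem self_adjoint_orthonormal_eigenbasis:
  fixes f :: "'a::euclidean_space \<Rightarrow> 'a"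
  assumes "linear f" and sym: "\<And>x y. f x \<bullet> y = x \<bullet> f y"
    and "subspace S" "f ` S \<subseteq> S"
  shows "\<exists>B. B \<subseteq> S \<and> pairwise orthogonal B \<and> (\<forall>b\<in>B. norm b = 1 \<and> (\<exists>c. f b = c *\<^sub>R b)) \<and> span B = S"
  using assms(3,4)
proof (induction "dim S" arbitrary: S rule: less_induct)
  case less
  show ?case
  proof (cases "S = {0}")
    case True
    then show ?thesis
      by (intro exI[of _ "{}"]) (simp add: pairwise_def)
  next
    case False
    then obtain v c where v: "v \<in> S" "norm v = 1" "f v = c *\<^sub>R v"
      using self_adjoint_eigenvector_exists[OF assms(1,2) less.prems] by blast
    let ?T = "{x \<in> S. v \<bullet> x = 0}"
    have "subspace ?T"
      using less.prems(1) by (auto simp: subspace_def inner_add_right)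
    moreover have "f ` ?T \<subseteq> ?T"
      using less.prems(2) v(3) by (auto simp: sym[symmetric])
    moreover have "dim ?T < dim S"
    proof (rule dim_psubset)
      have "v \<notin> ?T"
        using v(2) by auto
      then have "?T \<subset> S"
        using v(1) by blast
      then show "span ?T \<subset> span S"
        using \<open>subspace ?T\<close> less.prems(1) by (simp only: span_eq_iff[THEN iffD2])
    qed
    ultimately obtain B where B: "B \<subseteq> ?T" "pairwise orthogonal B"
      "\<forall>b\<in>B. norm b = 1 \<and> (\<exists>c. f b = c *\<^sub>R b)" "span B = ?T"
      using less.hyps by meson
    have "S \<subseteq> span (insert v B)"
    proof
      fix x assume "x \<in> S"
      then have "x - (v \<bullet> x) *\<^sub>R v \<in> ?T"
        using v less.prems(1)
        by (auto simp: inner_diff_right dot_square_norm intro!: subspace_diff subspace_scale)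
      then show "x \<in> span (insert v B)"
        using B(4) unfolding span_insert by blast
    qed
    moreover have "span (insert v B) \<subseteq> S"
      using v(1) B(1) less.prems(1) by (intro span_minimal) auto
    moreover have "pairwise orthogonal (insert v B)"
      using B(1,2) by (auto simp: pairwise_insert orthogonal_def inner_commute)
    ultimately show ?thesis
      using v B(1,3) by (intro exI[of _ "insert v B"]) auto
  qed
qed

text \<open>On an eigenvector \<open>b\<close> of \<open>g\<close> with eigenvalue \<open>c\<close>
  one has (h + c)(h - c) b = 0. So y = (h - c) b satisfies h y = - c y, which positivity of
  \<open>h\<close> excludes for c > 0 unless y = 0; for c = 0, h (h b) = 0 already gives h b =
  0.\<close>

lemma psd_op_eq_if_eq_square:
  fixes g h :: "'a::euclidean_space \<Rightarrow> 'a"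
  assumes g: "psd_op g" and h: "psd_op h" and eq: "\<And>x. g (g x) = h (h x)"
  shows "g = h"
proof -
  interpret g: linear g using g by (simp add: psd_op_def)
  interpret h: linear h using h by (simp add: psd_op_def)
  obtain B where B: "span B = UNIV" and ev: "\<And>b. b \<in> B \<Longrightarrow> norm b = 1 \<and> (\<exists>c. g b = c *\<^sub>R b)"
    using self_adjoint_orthonormal_eigenbasis[of g UNIV] g unfolding psd_op_def by auto
  have "g b = h b" if "b \<in> B" for b
  proof -
    obtain c where c: "g b = c *\<^sub>R b" and b: "b \<bullet> b = 1"
      using ev[OF \<open>b \<in> B\<close>] by (force simp: dot_square_norm)
    have "b \<bullet> g b \<ge> 0"
      using g by (simp add: psd_op_def)
    then have "c \<ge> 0"
      by (simp add: c b)
    define y where "y = h b - c *\<^sub>R b"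
    have "h (h b) = (c * c) *\<^sub>R b"
      using eq[of b] by (simp add: c g.scale)
    then have hy: "h y = - c *\<^sub>R y"
      by (simp add: y_def h.diff h.scale scaleR_diff_right)
    have "y = 0"
    proof (cases "c = 0")
      case True
      then have "h b \<bullet> h b = 0"
        using hy h by (simp add: y_def psd_op_def)
      then show ?thesis
        by (simp add: y_def True)
    next
      case False
      have "0 \<le> y \<bullet> h y"
        using h by (simp add: psd_op_def)
      then have "y \<bullet> y \<le> 0"
        using False \<open>c \<ge> 0\<close> by (simp add: hy mult_le_0_iff)
      then show ?thesis
        by (metis inner_eq_zero_iff inner_ge_zero order_antisym)
    qed
    then show ?thesis
      by (simp add: y_def c)
  qed
  then show ?thesis
    using linear_eq_on_span[OF g.linear_axioms h.linear_axioms] B by (metis UNIV_I ext)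
qed

lemma psd_op_sqrt_exists:
  fixes f :: "'a::euclidean_space \<Rightarrow> 'a"
  assumes f: "psd_op f"
  obtains g where "psd_op g" "\<And>x. g (g x) = f x"
proof -
  interpret f: linear f using f by (simp add: psd_op_def)
  obtain B where B: "span B = UNIV" "pairwise orthogonal B"
    and norm: "\<And>b. b \<in> B \<Longrightarrow> norm b = 1" and ev: "\<And>b. b \<in> B \<Longrightarrow> \<exists>c. f b = c *\<^sub>R b"
    using self_adjoint_orthonormal_eigenbasis[of f UNIV] f unfolding psd_op_def by auto
  have "finite B"
    using B(2) by (rule pairwise_orthogonal_imp_finite)
  have ortho: "b \<bullet> b' = (if b = b' then 1 else 0)" if "b \<in> B" "b' \<in> B" for b b'
    using that B(2) norm by (auto simp: pairwise_def orthogonal_def dot_square_norm)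
  \<comment> \<open>For an eigenvector of norm 1 this is the eigenvalue; written as a quadratic form
    it needs no choice and is nonnegative for every \<open>b\<close>.\<close>
  define c where "c b = b \<bullet> f b" for b
  have c: "f b = c b *\<^sub>R b" if "b \<in> B" for b
    using ev[OF that] ortho[OF that that] by (auto simp: c_def)
  have c_nonneg: "c b \<ge> 0" for b
    using f by (simp add: c_def psd_op_def)
  define g where "g x = (\<Sum>b\<in>B. (sqrt (c b) * (b \<bullet> x)) *\<^sub>R b)" for x
  have "linear g"
    by (rule linearI)
      (simp_all add: g_def inner_add_right algebra_simps sum.distrib scaleR_sum_right)
  then interpret g: linear g .
  have gb: "g b = sqrt (c b) *\<^sub>R b" if "b \<in> B" for b
  proof -
    have "g b = (\<Sum>b'\<in>B. if b' = b then sqrt (c b) *\<^sub>R b else 0)"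
      unfolding g_def using that by (intro sum.cong) (auto simp: ortho)
    then show ?thesis
      using that \<open>finite B\<close> by simp
  qed
  have "linear (\<lambda>x. g (g x))"
    using linear_compose[OF \<open>linear g\<close> \<open>linear g\<close>] by (simp add: o_def)
  then have "g (g x) = f x" for x
    by (rule linear_eq_on_span[OF _ f.linear_axioms, where B = B])
      (use B(1) c_nonneg in \<open>simp_all add: gb g.scale c\<close>)
  moreover have "psd_op g"
    unfolding psd_op_def
  proof (intro conjI allI)
    fix x y
    show "g x \<bullet> y = x \<bullet> g y"
      by (simp add: g_def inner_sum_left inner_sum_right inner_commute mult_ac)
    have "x \<bullet> g x = (\<Sum>b\<in>B. sqrt (c b) * (b \<bullet> x)\<^sup>2)"
      by (simp add: g_def inner_sum_right inner_commute mult_ac power2_eq_square)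
    then show "0 \<le> x \<bullet> g x"
      by (simp add: sum_nonneg c_nonneg)
  qed (fact \<open>linear g\<close>)
  ultimately show thesis
    by (rule that[rotated])
qed

subsection \<open>Positive semidefinite matrices and the geometric mean\<close>

text \<open>Identifies the form in \<open>psd_matrix\<close> with the real inner product, which lets
  matrices be treated as instances of \<open>psd_op\<close>.\<close>

lemma inner_eq_Re_hermitian_form:
  fixes x y :: "complex^'n"
  shows "x \<bullet> y = Re (\<Sum>i\<in>UNIV. cnj (x $ i) * y $ i)"
  by (simp add: inner_vec_def inner_complex_def)

lemma inner_matrix_vector_left:
  fixes A :: "complex^'n^'m"
  shows "(A *v x) \<bullet> y = x \<bullet> (adjoint_matrix A *v y)"
proof -
  have "(\<Sum>i\<in>UNIV. cnj ((A *v x) $ i) * y $ i) = (\<Sum>i\<in>UNIV. \<Sum>j\<in>UNIV. cnj (A $ i $ j) * cnj (x $ j) * y $ i)"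
    by (simp add: matrix_vector_mult_def sum_distrib_right)
  also have "\<dots> = (\<Sum>j\<in>UNIV. \<Sum>i\<in>UNIV. cnj (A $ i $ j) * cnj (x $ j) * y $ i)"
    by (rule sum.swap)
  also have "\<dots> = (\<Sum>j\<in>UNIV. cnj (x $ j) * (adjoint_matrix A *v y) $ j)"
    by (simp add: matrix_vector_mult_def adjoint_matrix_def map_matrix_def transpose_def
        sum_distrib_left mult_ac)
  finally show ?thesis
    by (simp add: inner_eq_Re_hermitian_form)
qed

lemma matrix_eq_if_inner_eq:
  fixes A B :: "complex^'n^'m"
  assumes "\<And>x y. x \<bullet> (A *v y) = x \<bullet> (B *v y)"
  shows "A = B"
  using assms by (metis matrix_eq vector_eq_rdot inner_commute)

lemma adjoint_matrix_adjoint [simp]: "adjoint_matrix (adjoint_matrix A) = A"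
  by (simp add: adjoint_matrix_def map_matrix_def transpose_def vec_eq_iff)

lemma adjoint_matrix_mult: "adjoint_matrix (A ** B) = adjoint_matrix B ** adjoint_matrix A"
  by (rule matrix_eq_if_inner_eq)
    (simp add: inner_matrix_vector_left[symmetric] matrix_vector_mul_assoc[symmetric])

lemma adjoint_matrix_mat_1 [simp]: "adjoint_matrix (mat 1) = mat 1"
  by (rule matrix_eq_if_inner_eq) (simp add: inner_matrix_vector_left[symmetric])

lemma hermitian_matrix_iff_inner:
  "hermitian_matrix A \<longleftrightarrow> (\<forall>x y. (A *v x) \<bullet> y = x \<bullet> (A *v y))"
  unfolding hermitian_matrix_def
  by (metis inner_matrix_vector_left matrix_eq_if_inner_eq)

lemma linear_matrix_vector: "linear ((*v) (A :: complex^'n^'m))"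
  using matrix_vector_mul_linear[of A] by simp

lemma bounded_linear_matrix_vector: "bounded_linear ((*v) (A :: complex^'n^'m))"
  using linear_matrix_vector linear_conv_bounded_linear by blast

lemma psd_matrix_iff_psd_op: "psd_matrix A \<longleftrightarrow> psd_op ((*v) A)"
  unfolding psd_matrix_def psd_op_def hermitian_matrix_iff_inner inner_eq_Re_hermitian_form[symmetric]
  by (simp add: linear_matrix_vector)

lemma psd_matrix_adjoint: "psd_matrix A \<Longrightarrow> adjoint_matrix A = A"
  by (simp add: psd_matrix_def hermitian_matrix_def)

lemma psd_matrix_inner_commute: "psd_matrix A \<Longrightarrow> (A *v x) \<bullet> y = x \<bullet> (A *v y)"
  by (simp add: psd_matrix_iff_psd_op psd_op_def)

lemma psd_matrix_nonneg: "psd_matrix A \<Longrightarrow> 0 \<le> x \<bullet> (A *v x)"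
  by (simp add: psd_matrix_iff_psd_op psd_op_def)

lemma psd_matrixI:
  assumes "adjoint_matrix A = A" "\<And>x. 0 \<le> x \<bullet> (A *v x)"
  shows "psd_matrix A"
  using assms by (simp add: psd_matrix_def hermitian_matrix_def inner_eq_Re_hermitian_form)

lemma psd_matrix_congruence:
  assumes "psd_matrix A"
  shows "psd_matrix (adjoint_matrix M ** A ** M)"
proof (rule psd_matrixI)
  show "0 \<le> x \<bullet> (adjoint_matrix M ** A ** M *v x)" for x
    using psd_matrix_nonneg[OF assms, of "M *v x"]
    by (simp add: inner_matrix_vector_left matrix_vector_mul_assoc matrix_mul_assoc)
qed (simp add: adjoint_matrix_mult psd_matrix_adjoint[OF assms] matrix_mul_assoc)

lemma psd_matrix_add: "psd_matrix A \<Longrightarrow> psd_matrix B \<Longrightarrow> psd_matrix (A + B)"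
  by (simp add: psd_matrix_iff_psd_op psd_op_def matrix_vector_mult_add_rdistrib inner_add
      linear_matrix_vector)

lemma scaleR_matrix_vector: "(c *\<^sub>R A) *v x = c *\<^sub>R (A *v x)" for A :: "complex^'n^'m"
  by (simp add: matrix_vector_mult_def vec_eq_iff scaleR_sum_right)

lemma matrix_vector_scaleR: "A *v (c *\<^sub>R x) = c *\<^sub>R (A *v x)" for A :: "complex^'n^'m"
  by (rule linear_cmul[OF linear_matrix_vector])

lemma scaleR_matrix_mult_left: "(c *\<^sub>R A) ** B = c *\<^sub>R (A ** B)" for A :: "complex^'n^'m"
  by (simp add: matrix_matrix_mult_def vec_eq_iff scaleR_sum_right)

lemma scaleR_matrix_mult_right: "A ** (c *\<^sub>R B) = c *\<^sub>R (A ** B)" for A :: "complex^'n^'m"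
  by (simp add: matrix_matrix_mult_def vec_eq_iff scaleR_sum_right)

lemma psd_matrix_scaleR: "psd_matrix A \<Longrightarrow> 0 \<le> c \<Longrightarrow> psd_matrix (c *\<^sub>R A)"
  by (simp add: psd_matrix_iff_psd_op psd_op_def scaleR_matrix_vector linear_matrix_vector)

lemma psd_matrix_mat_1: "psd_matrix (mat 1)"
  by (simp add: psd_matrix_iff_psd_op psd_op_def linear_matrix_vector)

text \<open>A positive real-linear root of a matrix is complex-linear: conjugating it with the
  multiplication by \<open>\<i>\<close> gives another positive root of the same matrix, so uniqueness applies.\<close>
lemma psd_matrix_sqrt_exists:
  fixes A :: "complex^'n^'n"
  assumes "psd_matrix A"
  obtains R where "psd_matrix R" "R ** R = A"
proof -
  obtain g where g: "psd_op g" and gg: "\<And>x. g (g x) = A *v x"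
    using psd_op_sqrt_exists[of "(*v) A"] assms by (auto simp: psd_matrix_iff_psd_op)
  interpret g: linear g using g by (simp add: psd_op_def)
  let ?J = "\<lambda>x :: complex^'n. \<i> *s x"
  have J: "linear ?J"
    by (rule linearI) (simp_all add: vec_eq_iff algebra_simps)
  have JJ: "?J (?J x) = - x" for x
    by (simp add: vec_eq_iff)
  have inner_J: "?J x \<bullet> y = - (x \<bullet> ?J y)" for x y
    by (simp add: inner_vec_def inner_complex_def sum_negf[symmetric])
  have AJ: "A *v ?J x = ?J (A *v x)" for x
    by (simp add: vec.scale)
  define h where "h x = - ?J (g (?J x))" for x
  have "linear h"
    unfolding h_def
    by (intro linear_compose_neg linear_compose[OF linear_compose[OF J g.linear_axioms] J, unfolded o_def])
  moreover have "h x \<bullet> y = x \<bullet> h y" for x y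
    using g by (simp add: h_def psd_op_def inner_J)
  moreover have "x \<bullet> h x = ?J x \<bullet> g (?J x)" for x
    by (simp add: h_def inner_J)
  then have "0 \<le> x \<bullet> h x" for x
    using g by (simp add: psd_op_def)
  ultimately have "psd_op h"
    by (simp add: psd_op_def)
  moreover have "g (g x) = h (h x)" for x
    by (simp add: h_def gg linear_neg[OF J] JJ g.neg AJ)
  ultimately have gh: "g = h"
    using g by (intro psd_op_eq_if_eq_square)
  have gJ: "g (?J x) = ?J (g x)" for x
    by (subst (2) gh) (simp add: h_def linear_neg[OF J] JJ)
  have "g (c *s x) = c *s g x" for c x
  proof -
    have split: "c *s y = Re c *\<^sub>R y + Im c *\<^sub>R ?J y" for y :: "complex^'n"
      by (simp add: vec_eq_iff complex_eq_iff)
    show ?thesis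
      by (simp only: split g.add g.scale gJ)
  qed
  then have "Vector_Spaces.linear (*s) (*s) g"
    by unfold_locales (simp_all add: g.add)
  then have R: "matrix g *v x = g x" for x
    by (rule matrix_works)
  show thesis
  proof
    show "psd_matrix (matrix g)"
      using g by (simp add: psd_matrix_iff_psd_op R[abs_def])
    show "matrix g ** matrix g = A"
      by (simp add: matrix_eq matrix_vector_mul_assoc[symmetric] R gg)
  qed
qed

lemma psd_matrix_sqrt_unique:
  fixes R T :: "complex^'n^'n"
  assumes "psd_matrix R" "psd_matrix T" "R ** R = T ** T"
  shows "R = T"
  using psd_op_eq_if_eq_square[of "(*v) R" "(*v) T"] assms
  by (simp add: psd_matrix_iff_psd_op matrix_vector_mul_assoc matrix_eq)

lemma psd_sqrt_eqI: "psd_matrix R \<Longrightarrow> R ** R = A \<Longrightarrow> psd_sqrt A = R"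
  unfolding psd_sqrt_def by (rule the_equality) (auto intro: psd_matrix_sqrt_unique)

lemma
  assumes "psd_matrix A"
  shows psd_matrix_psd_sqrt: "psd_matrix (psd_sqrt A)"
    and psd_sqrt_mult_self: "psd_sqrt A ** psd_sqrt A = A"
  using psd_matrix_sqrt_exists[OF assms] psd_sqrt_eqI by metis+

section \<open>Matrix inverses and the Riccati equation\<close>

lemma matrix_inv_mult:
  assumes "invertible (A :: complex^'n^'n)"
  shows matrix_inv_right: "A ** matrix_inv A = mat 1" and matrix_inv_left: "matrix_inv A ** A = mat 1"
  using someI_ex[of "\<lambda>A'. A ** A' = mat 1 \<and> A' ** A = mat 1"] assms
  unfolding matrix_inv_def invertible_def by auto

lemma matrix_inv_eqI:
  assumes "(A :: complex^'n^'n) ** B = mat 1"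
  shows "matrix_inv A = B"
proof -
  have "invertible A"
    using assms invertible_right_inverse by blast
  then show ?thesis
    using assms by (metis matrix_inv_left matrix_mul_assoc matrix_mul_lid matrix_mul_rid)
qed

text \<open>The inverse is a congruence of \<open>A\<close> by itself: A^-1 = A^-1 A A^-1.\<close>

lemma psd_matrix_matrix_inv:
  assumes "psd_matrix A" "invertible A"
  shows "psd_matrix (matrix_inv A)"
proof -
  have "adjoint_matrix (matrix_inv A) = matrix_inv A"
    using matrix_inv_mult[OF assms(2)] psd_matrix_adjoint[OF assms(1)]
    by (metis adjoint_matrix_mat_1 adjoint_matrix_mult matrix_inv_eqI)
  then show ?thesis
    using psd_matrix_congruence[OF assms(1), of "matrix_inv A"]
    by (simp add: matrix_inv_left[OF assms(2)])
qed

lemma geometric_mean_factors: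
  assumes X: "psd_matrix X" "invertible X"
  obtains R R' where "psd_matrix R" "psd_matrix R'" "R ** R' = mat 1" "R' ** R = mat 1"
    "matrix_inv X = R' ** R'" "\<And>Y. geometric_mean X Y = R ** psd_sqrt (R' ** Y ** R') ** R"
proof
  define R where "R = psd_sqrt X"
  define R' where "R' = matrix_inv R"
  show "psd_matrix R"
    using X by (simp add: R_def psd_matrix_psd_sqrt)
  have RR: "R ** R = X"
    using X by (simp add: R_def psd_sqrt_mult_self)
  then have "R ** (R ** matrix_inv X) = mat 1"
    using matrix_inv_right[OF X(2)] by (simp add: matrix_mul_assoc)
  then have "invertible R"
    using invertible_right_inverse by blast
  note RR' = matrix_inv_mult[OF this, folded R'_def]
  show "R ** R' = mat 1" "R' ** R = mat 1"
    by (fact RR')+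
  show "psd_matrix R'"
    unfolding R'_def by (rule psd_matrix_matrix_inv) fact+
  have "X ** (R' ** R') = mat 1"
    using RR' RR by (metis matrix_mul_assoc matrix_mul_rid)
  then show "matrix_inv X = R' ** R'"
    by (rule matrix_inv_eqI)
  show "geometric_mean X Y = R ** psd_sqrt (R' ** Y ** R') ** R" for Y
    by (simp add: geometric_mean_def Let_def R_def R'_def)
qed

text \<open>The geometric mean \<open>G\<close> of \<open>X\<close> and \<open>Y\<close> is the unique positive solution of the
  Riccati equation \<open>G X\<^sup>-\<^sup>1 G = Y\<close>.\<close>
lemma geometric_mean_eqI:
  assumes X: "psd_matrix X" "invertible X" and G: "psd_matrix G" and eq: "G ** matrix_inv X ** G = Y"
  shows "geometric_mean X Y = G"
proof -
  obtain R R' where R': "psd_matrix R'" and RR': "R ** R' = mat 1" "R' ** R = mat 1"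
    and inv_X: "matrix_inv X = R' ** R'"
    and gm: "geometric_mean X Y = R ** psd_sqrt (R' ** Y ** R') ** R"
    using geometric_mean_factors[OF X] by metis
  have "psd_sqrt (R' ** Y ** R') = R' ** G ** R'"
  proof (rule psd_sqrt_eqI)
    show "psd_matrix (R' ** G ** R')"
      using psd_matrix_congruence[OF G, of R'] psd_matrix_adjoint[OF R'] by simp
    show "R' ** G ** R' ** (R' ** G ** R') = R' ** Y ** R'"
      by (simp add: eq[symmetric] inv_X matrix_mul_assoc)
  qed
  then have "geometric_mean X Y = (R ** R') ** G ** (R' ** R)"
    by (simp add: gm matrix_mul_assoc)
  then show ?thesis
    by (simp add: RR')
qed

text \<open>The factor X^-1 = R' R' cancels the inner copies of \<open>R\<close>, leaving R T^2 R =
  Y. Together with uniqueness this replaces the square-root formula: the later sections use only the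
  Riccati equation.\<close>

lemma
  assumes X: "psd_matrix X" "invertible X" and Y: "psd_matrix Y"
  shows psd_matrix_geometric_mean: "psd_matrix (geometric_mean X Y)"
    and geometric_mean_Riccati: "geometric_mean X Y ** matrix_inv X ** geometric_mean X Y = Y"
proof -
  obtain R R' where R: "psd_matrix R" and R': "psd_matrix R'"
    and RR': "R ** R' = mat 1" "R' ** R = mat 1" and inv_X: "matrix_inv X = R' ** R'"
    and gm: "geometric_mean X Y = R ** psd_sqrt (R' ** Y ** R') ** R"
    using geometric_mean_factors[OF X] by metis
  define T where "T = psd_sqrt (R' ** Y ** R')"
  have "psd_matrix (R' ** Y ** R')"
    using psd_matrix_congruence[OF Y, of R'] psd_matrix_adjoint[OF R'] by simp
  then have T: "psd_matrix T" "T ** T = R' ** Y ** R'"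
    by (simp_all add: T_def psd_matrix_psd_sqrt psd_sqrt_mult_self)
  show "psd_matrix (geometric_mean X Y)"
    using psd_matrix_congruence[OF T(1), of R] psd_matrix_adjoint[OF R] by (simp add: gm T_def)
  have "R ** T ** R ** (R' ** R') ** (R ** T ** R) = R ** T ** (R ** R') ** (R' ** R) ** T ** R"
    by (simp add: matrix_mul_assoc)
  also have "\<dots> = R ** (T ** T) ** R"
    by (simp add: RR' matrix_mul_assoc)
  also have "\<dots> = (R ** R') ** Y ** (R' ** R)"
    by (simp add: T(2) matrix_mul_assoc)
  finally show "geometric_mean X Y ** matrix_inv X ** geometric_mean X Y = Y"
    by (simp add: gm inv_X RR' T_def)
qed

subsection \<open>Block matrices\<close>

text \<open>The size of the large matrices is known only through the cardinality of their index
  type, so the block structure comes from a bijection with pairs (block, position).\<close>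

locale block_indexing =
  fixes \<phi> :: "'m::finite \<Rightarrow> 'k::finite \<times> 'n::finite"
  assumes bij: "bij \<phi>"
begin

definition block :: "'k \<Rightarrow> complex^'m \<Rightarrow> complex^'n" where
  "block k x = (\<chi> a. x $ inv \<phi> (k, a))"

text \<open>The only nonzero blocks are \<open>X k\<close> at the positions \<open>(k, \<sigma> k)\<close>.\<close>
definition block_matrix :: "('k \<Rightarrow> 'k) \<Rightarrow> ('k \<Rightarrow> complex^'n^'n) \<Rightarrow> complex^'m^'m" where
  "block_matrix \<sigma> X =
     (\<chi> i j. if fst (\<phi> j) = \<sigma> (fst (\<phi> i)) then X (fst (\<phi> i)) $ snd (\<phi> i) $ snd (\<phi> j) else 0)"

lemma phi_inv [simp]: "\<phi> (inv \<phi> p) = p"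
  using bij by (simp add: bij_is_surj surj_f_inv_f)

lemma inv_phi [simp]: "inv \<phi> (\<phi> i) = i"
  using bij by (simp add: bij_is_inj)

lemma sum_blocks: "(\<Sum>i\<in>UNIV. f i) = (\<Sum>k\<in>UNIV. \<Sum>a\<in>UNIV. f (inv \<phi> (k, a)))"
proof -
  have "(\<Sum>i\<in>UNIV. f i) = (\<Sum>p\<in>UNIV. f (inv \<phi> p))"
    by (rule sum.reindex_bij_witness[of _ "inv \<phi>" \<phi>]) auto
  also have "\<dots> = (\<Sum>p\<in>UNIV \<times> UNIV. f (inv \<phi> p))"
    by simp
  also have "\<dots> = (\<Sum>k\<in>UNIV. \<Sum>a\<in>UNIV. f (inv \<phi> (k, a)))"
    by (simp add: sum.cartesian_product case_prod_unfold)
  finally show ?thesis .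
qed

lemma eq_if_blocks_eq:
  assumes "\<And>k. block k x = block k y"
  shows "x = y"
proof (rule vec_eq_iff[THEN iffD2, rule_format])
  show "x $ i = y $ i" for i
    using arg_cong[OF assms[of "fst (\<phi> i)"], of "\<lambda>v. v $ snd (\<phi> i)"] by (simp add: block_def)
qed

lemma inner_blocks: "x \<bullet> y = (\<Sum>k\<in>UNIV. block k x \<bullet> block k y)"
  by (simp add: inner_vec_def block_def sum_blocks[of "\<lambda>i. x $ i \<bullet> y $ i"])

lemma norm_blocks: "(norm x)\<^sup>2 = (\<Sum>k\<in>UNIV. (norm (block k x))\<^sup>2)"
  by (simp add: power2_norm_eq_inner inner_blocks)

lemma block_surj: "\<exists>x. \<forall>k. block k x = y k"
  by (rule exI[of _ "\<chi> i. y (fst (\<phi> i)) $ snd (\<phi> i)"]) (simp add: block_def vec_eq_iff)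

lemma block_block_matrix [simp]: "block k (block_matrix \<sigma> X *v x) = X k *v block (\<sigma> k) x"
proof -
  have "(\<Sum>l\<in>UNIV. \<Sum>b\<in>UNIV. (if l = \<sigma> k then X k $ a $ b else 0) * x $ inv \<phi> (l, b))
      = (\<Sum>l\<in>UNIV. if l = \<sigma> k then \<Sum>b\<in>UNIV. X k $ a $ b * x $ inv \<phi> (l, b) else 0)" for a
    by (intro sum.cong) auto
  then show ?thesis
    by (simp add: vec_eq_iff block_def block_matrix_def matrix_vector_mult_def
        sum_blocks[of "\<lambda>j. _ j * x $ j"] cong: if_cong)
qed

text \<open>The permutations compose in reverse because block row \<open>k\<close> reads block
  \<open>\<sigma> k\<close> of what the right factor produces, and that block reads block
  \<open>\<tau> (\<sigma> k)\<close>.\<close>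

lemma block_matrix_mult:
  "block_matrix \<sigma> X ** block_matrix \<tau> Y = block_matrix (\<tau> \<circ> \<sigma>) (\<lambda>k. X k ** Y (\<sigma> k))"
  unfolding matrix_eq matrix_vector_mul_assoc[symmetric]
  by (intro allI eq_if_blocks_eq) (simp, simp add: matrix_vector_mul_assoc)

lemma block_matrix_id: "block_matrix id (\<lambda>_. mat 1) = mat 1"
  unfolding matrix_eq by (intro allI eq_if_blocks_eq) simp

lemma adjoint_block_matrix:
  assumes "bij \<sigma>"
  shows "adjoint_matrix (block_matrix \<sigma> X) = block_matrix (inv \<sigma>) (\<lambda>k. adjoint_matrix (X (inv \<sigma> k)))"
proof (rule matrix_eq_if_inner_eq)
  fix x y
  have "x \<bullet> (adjoint_matrix (block_matrix \<sigma> X) *v y) = (\<Sum>k\<in>UNIV. (X k *v block (\<sigma> k) x) \<bullet> block k y)"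
    by (simp only: inner_matrix_vector_left[symmetric]) (simp add: inner_blocks)
  also have "\<dots> = (\<Sum>k\<in>UNIV. (X (inv \<sigma> k) *v block k x) \<bullet> block (inv \<sigma> k) y)"
    using assms
    by (intro sum.reindex_bij_witness[of _ "inv \<sigma>" \<sigma>]) (auto simp: bij_is_inj bij_is_surj surj_f_inv_f)
  also have "\<dots> = x \<bullet> (block_matrix (inv \<sigma>) (\<lambda>k. adjoint_matrix (X (inv \<sigma> k))) *v y)"
    by (simp add: inner_blocks inner_matrix_vector_left)
  finally show "x \<bullet> (adjoint_matrix (block_matrix \<sigma> X) *v y)
    = x \<bullet> (block_matrix (inv \<sigma>) (\<lambda>k. adjoint_matrix (X (inv \<sigma> k))) *v y)" .
qed

lemma psd_block_diagonal:
  assumes "\<And>k. psd_matrix (X k)"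
  shows "psd_matrix (block_matrix id X)"
  using assms by (intro psd_matrixI)
    (simp_all add: adjoint_block_matrix psd_matrix_adjoint inner_blocks sum_nonneg psd_matrix_nonneg)

lemma matrix_inv_block_diagonal:
  assumes "\<And>k. invertible (X k)"
  shows "matrix_inv (block_matrix id X) = block_matrix id (\<lambda>k. matrix_inv (X k))"
  using assms
  by (intro matrix_inv_eqI) (simp add: block_matrix_mult matrix_inv_right block_matrix_id)

lemma invertible_block_diagonal:
  assumes "\<And>k. invertible (X k)"
  shows "invertible (block_matrix id X)"
proof -
  have "block_matrix id X ** block_matrix id (\<lambda>k. matrix_inv (X k)) = mat 1"
    using assms by (simp add: block_matrix_mult matrix_inv_right block_matrix_id)
  then show ?thesis
    using invertible_right_inverse by blast
qed

lemma onorm_block_diagonal_le: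
  assumes "0 \<le> c" "\<And>k y. norm (X k *v y) \<le> c * norm y"
  shows "onorm ((*v) (block_matrix id X)) \<le> c"
proof (rule onorm_bound[OF \<open>0 \<le> c\<close>])
  fix x
  have "(norm (block_matrix id X *v x))\<^sup>2 \<le> (\<Sum>k\<in>UNIV. (c * norm (block k x))\<^sup>2)"
    unfolding norm_blocks by (auto intro!: sum_mono power_mono assms(2))
  also have "\<dots> = (c * norm x)\<^sup>2"
    by (simp add: power_mult_distrib norm_blocks[of x] sum_distrib_left)
  finally show "norm (block_matrix id X *v x) \<le> c * norm x"
    by (rule power2_le_imp_le) (simp add: \<open>0 \<le> c\<close>)
qed

end

lemma block_indexing_exists:
  assumes "CARD('m::finite) = CARD('k::finite) * CARD('n::finite)"
  obtains \<phi> :: "'m::finite \<Rightarrow> 'k::finite \<times> 'n::finite" where "block_indexing \<phi>"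
proof -
  have "card (UNIV :: 'm set) = card (UNIV :: ('k \<times> 'n) set)"
    using assms by (simp add: card_prod)
  then obtain \<phi> :: "'m \<Rightarrow> 'k \<times> 'n" where "bij \<phi>"
    using finite_same_card_bij[OF finite finite] by blast
  then show thesis
    by (intro that) (simp add: block_indexing_def)
qed

subsection \<open>Compression to a unit vector\<close>

text \<open>For a unit vector this is the orthogonal projection onto the complex line of
  \<open>x\<close>.\<close>

definition outer_square :: "complex^'n \<Rightarrow> complex^'n^'n" where
  "outer_square x = (\<chi> i j. x $ i * cnj (x $ j))"

lemma outer_square_vector:
  "outer_square x *v y = (\<Sum>j\<in>UNIV. cnj (x $ j) * y $ j) *s x"
  by (simp add: outer_square_def matrix_vector_mult_def vec_eq_iff sum_distrib_left sum_distrib_right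
      mult_ac)

text \<open>Needed because the inner product sees only real parts: the imaginary part of the form is
  the inner product of \<open>\<i> *s x\<close> with \<open>G *v x\<close>, and self-adjointness
  makes that equal to its own negative.\<close>

lemma hermitian_form_real:
  assumes "psd_matrix G"
  shows "(\<Sum>j\<in>UNIV. cnj (x $ j) * (G *v x) $ j) = of_real (x \<bullet> (G *v x))"
proof (rule complex_eqI)
  let ?c = "\<Sum>j\<in>UNIV. cnj (x $ j) * (G *v x) $ j"
  have "(\<i> *s x) \<bullet> (G *v x) = x \<bullet> (\<i> *s (G *v x))"
    using psd_matrix_inner_commute[OF assms, of "\<i> *s x" x] by (simp add: vec.scale inner_commute)
  also have "\<dots> = - ((\<i> *s x) \<bullet> (G *v x))"
    by (simp add: inner_vec_def inner_complex_def sum_negf[symmetric])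
  finally have "(\<i> *s x) \<bullet> (G *v x) = 0"
    by simp
  then have "Re (\<Sum>j\<in>UNIV. - \<i> * (cnj (x $ j) * (G *v x) $ j)) = 0"
    by (simp add: inner_eq_Re_hermitian_form)
  then have "Re (- \<i> * ?c) = 0"
    by (simp only: sum_distrib_left)
  then show "Im ?c = Im (of_real (x \<bullet> (G *v x)))"
    by simp
qed (simp add: inner_eq_Re_hermitian_form)

context
  fixes x :: "complex^'n"
  assumes unit: "norm x = 1"
begin

lemma outer_square_self: "outer_square x *v x = x"
proof -
  have "(\<Sum>j\<in>UNIV. cnj (x $ j) * x $ j) = of_real (x \<bullet> x)"
    using hermitian_form_real[OF psd_matrix_mat_1, of x] by simp
  then show ?thesis
    using unit by (simp add: outer_square_vector dot_square_norm)
qed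

lemma outer_square_idem: "outer_square x *v (outer_square x *v y) = outer_square x *v y"
  by (simp add: outer_square_vector[of x y] vec.scale outer_square_self)

lemma psd_outer_square: "psd_matrix (outer_square x)"
proof (rule psd_matrixI)
  show adj: "adjoint_matrix (outer_square x) = outer_square x"
    by (simp add: adjoint_matrix_def map_matrix_def transpose_def outer_square_def vec_eq_iff mult.commute)
  show "0 \<le> y \<bullet> (outer_square x *v y)" for y
    using inner_matrix_vector_left[of "outer_square x" y "outer_square x *v y"]
    by (metis adj inner_ge_zero outer_square_idem)
qed

lemma norm_outer_square_le: "norm (outer_square x *v y) \<le> norm y"
proof -
  let ?z = "outer_square x *v y"
  have "norm ?z * norm ?z = y \<bullet> ?z"
    using psd_matrix_inner_commute[OF psd_outer_square, of y ?z]
    by (simp add: outer_square_idem dot_square_norm power2_eq_square[symmetric])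
  also have "\<dots> \<le> norm y * norm ?z"
    by (rule norm_cauchy_schwarz)
  finally show ?thesis
    by (cases "?z = 0") auto
qed

text \<open>The vector projects to a multiple of \<open>x\<close>, and \<open>G *v x\<close>
  projects back to its component along \<open>x\<close>, whose coefficient is real. This is where a
  matrix turns into a single number.\<close>

lemma outer_square_compression:
  assumes "psd_matrix G"
  shows "outer_square x *v (G *v (outer_square x *v y)) = (x \<bullet> (G *v x)) *\<^sub>R (outer_square x *v y)"
proof -
  have "outer_square x *v (G *v x) = (x \<bullet> (G *v x)) *\<^sub>R x"
    by (simp add: outer_square_vector[of x "G *v x"] hermitian_form_real[OF assms] vec_eq_iff
        scaleR_conv_of_real[where 'a = complex])
  then show ?thesis
    by (simp add: outer_square_vector[of x y] vec.scale vec_eq_iff scaleR_conv_of_real[where 'a = complex])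
qed

text \<open>With P the projection, K G K = P G P + e P G + e G P + e^2 G. The first term has norm at
  most <x, G x>; each of the other three is at most e L, using e^2 <= e.\<close>

lemma norm_near_compression_le:
  assumes G: "psd_matrix G" and L: "\<And>y. norm (G *v y) \<le> L * norm y" "0 \<le> L"
    and e: "0 \<le> e" "e \<le> 1"
  defines "K \<equiv> outer_square x + e *\<^sub>R mat 1"
  shows "norm ((K ** G ** K) *v y) \<le> (x \<bullet> (G *v x) + 3 * e * L) * norm y"
proof -
  let ?P = "outer_square x"
  let ?q = "x \<bullet> (G *v x)"
  have "(K ** G ** K) *v y = ?q *\<^sub>R (?P *v y) + (e *\<^sub>R (?P *v (G *v y)) + (e *\<^sub>R (G *v (?P *v y)) + (e * e) *\<^sub>R (G *v y)))"
    by (simp add: K_def matrix_vector_mul_assoc[symmetric] matrix_vector_mult_add_rdistrib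
        scaleR_matrix_vector matrix_vector_right_distrib matrix_vector_scaleR
        outer_square_compression[OF G] algebra_simps)
  also have "norm \<dots> \<le> ?q * norm y + (e * (L * norm y) + (e * (L * norm y) + e * (L * norm y)))"
  proof (intro norm_triangle_mono)
    show "norm (?q *\<^sub>R (?P *v y)) \<le> ?q * norm y"
      using psd_matrix_nonneg[OF G, of x] norm_outer_square_le by (simp add: mult_left_mono)
    show "norm (e *\<^sub>R (?P *v (G *v y))) \<le> e * (L * norm y)"
      using e norm_outer_square_le[of "G *v y"] L(1)[of y] by (simp add: mult_left_mono)
    have "norm (G *v (?P *v y)) \<le> L * norm y"
      using L(1)[of "?P *v y"] mult_left_mono[OF norm_outer_square_le[of y] L(2)] by linarith
    then show "norm (e *\<^sub>R (G *v (?P *v y))) \<le> e * (L * norm y)"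
      using e by (simp add: mult_left_mono)
    have "(e * e) * norm (G *v y) \<le> e * (L * norm y)"
      using e L by (intro mult_mono) (auto simp: mult_left_le)
    then show "norm ((e * e) *\<^sub>R (G *v y)) \<le> e * (L * norm y)"
      using e by simp
  qed
  finally show ?thesis
    by (simp add: algebra_simps)
qed

end

lemma invertible_add_scaleR_mat_1:
  fixes P :: "complex^'n^'n"
  assumes "psd_matrix P" "0 < e"
  shows "invertible (P + e *\<^sub>R mat 1)"
proof -
  have "y = 0" if "(P + e *\<^sub>R mat 1) *v y = 0" for y
  proof -
    have "y \<bullet> (P *v y) + e * (y \<bullet> y) = y \<bullet> ((P + e *\<^sub>R mat 1) *v y)"
      by (simp add: matrix_vector_mult_add_rdistrib scaleR_matrix_vector inner_add_right)
    then have "e * (y \<bullet> y) \<le> 0"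
      using psd_matrix_nonneg[OF assms(1), of y] that by (simp del: mult_le_0_iff)
    then have "y \<bullet> y \<le> 0"
      using assms(2) by (simp add: mult_le_0_iff)
    then show "y = 0"
      by (metis inner_eq_zero_iff inner_ge_zero order_antisym)
  qed
  then show ?thesis
    unfolding invertible_left_inverse matrix_left_invertible_ker by blast
qed

section \<open>From the norm inequality to a bound on the largest quadratic form\<close>

context block_indexing
begin

text \<open>The limit in e is replaced by one fixed \<open>e\<close>: if all forms were below 1, a
  small enough \<open>e\<close> would keep the norm of the mean below 1, while the norm of
  \<open>N\<close> is at least (1 + e)^2.\<close>

lemma exists_inner_geometric_mean_ge_1:
  fixes A :: "'k \<Rightarrow> complex^'n^'n"
  assumes norm_bound: "\<And>(S :: complex^'m^'m) N.
      psd_matrix S \<Longrightarrow> invertible S \<Longrightarrow> normal_matrix N \<Longrightarrow> invertible N \<Longrightarrow>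
      onorm ((*v) N) \<le> onorm ((*v) (geometric_mean S (adjoint_matrix N ** matrix_inv S ** N)))"
    and A: "\<And>k. psd_matrix (A k)" "\<And>k. invertible (A k)"
    and \<sigma>: "bij \<sigma>" and unit: "norm x = 1"
  shows "\<exists>k. 1 \<le> x \<bullet> (geometric_mean (A k) (matrix_inv (A (\<sigma> k))) *v x)"
proof (rule ccontr)
  define G where "G k = geometric_mean (A k) (matrix_inv (A (\<sigma> k)))" for k
  have G: "psd_matrix (G k)" "G k ** matrix_inv (A k) ** G k = matrix_inv (A (\<sigma> k))" for k
    unfolding G_def
    by (intro psd_matrix_geometric_mean geometric_mean_Riccati A psd_matrix_matrix_inv)+
  assume "\<not> ?thesis"
  then have lt1: "x \<bullet> (G k *v x) < 1" for k
    by (auto simp: G_def not_le)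
  define q where "q = Max (range (\<lambda>k. x \<bullet> (G k *v x)))"
  have q: "x \<bullet> (G k *v x) \<le> q" for k
    by (simp add: q_def)
  have "q < 1"
    using lt1 by (simp add: q_def)
  have "0 \<le> q"
    using q psd_matrix_nonneg[OF G(1)] order_trans by blast
  define L where "L = (\<Sum>k\<in>UNIV. onorm ((*v) (G k)))"
  have "0 \<le> L"
    by (simp add: L_def sum_nonneg onorm_pos_le bounded_linear_matrix_vector)
  have L: "norm (G k *v y) \<le> L * norm y" for k y
  proof -
    have "onorm ((*v) (G k)) \<le> L"
      unfolding L_def
      by (rule member_le_sum) (simp_all add: onorm_pos_le bounded_linear_matrix_vector)
    then have "onorm ((*v) (G k)) * norm y \<le> L * norm y"
      by (rule mult_right_mono) simp
    then show ?thesis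
      using onorm[OF bounded_linear_matrix_vector, of "G k" y] by linarith
  qed
  \<comment> \<open>Chosen so that q + 3 e L = 1 - e.\<close>
  define e where "e = (1 - q) / (3 * L + 1)"
  have e: "0 < e" "e \<le> 1" "q + 3 * e * L < 1"
    using \<open>q < 1\<close> \<open>0 \<le> q\<close> \<open>0 \<le> L\<close> by (simp_all add: e_def field_simps)
  define K where "K = outer_square x + e *\<^sub>R mat 1"
  have K: "psd_matrix K" "invertible K"
    unfolding K_def using e(1)
    by (simp_all add: psd_matrix_add psd_matrix_scaleR psd_matrix_mat_1 psd_outer_square[OF unit]
        invertible_add_scaleR_mat_1)
  define K' where "K' = matrix_inv K"
  have KK': "K ** K' = mat 1" "K' ** K = mat 1"
    using matrix_inv_mult[OF K(2)] by (simp_all add: K'_def)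
  have K'K_assoc: "M ** K' ** K = M" "M ** K ** K' = M" for M :: "complex^'n^'n"
    using KK' by (simp_all flip: matrix_mul_assoc)
  have Kx: "K *v x = (1 + e) *\<^sub>R x"
    by (simp add: K_def matrix_vector_mult_add_rdistrib scaleR_matrix_vector outer_square_self[OF unit]
        algebra_simps)

  define S where "S = block_matrix id (\<lambda>k. K ** A k ** K)"
  \<comment> \<open>The inverse permutation sits in \<open>N\<close> so that its adjoint, the left
    factor in \<open>adjoint_matrix N ** matrix_inv S ** N\<close>, carries \<open>\<sigma>\<close>
    and row \<open>k\<close> meets the block of \<open>S\<close> belonging to
    \<open>A (\<sigma> k)\<close>.\<close>
  define N where "N = block_matrix (inv \<sigma>) (\<lambda>_. K ** K)"
  have \<sigma>_inv: "inv \<sigma> \<circ> \<sigma> = id" "\<sigma> \<circ> inv \<sigma> = id" "inv (inv \<sigma>) = \<sigma>" "bij (inv \<sigma>)"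
    using \<sigma> by (simp_all add: bij_is_inj bij_is_surj surj_iff[THEN iffD1] inv_inv_eq bij_imp_bij_inv)
  have adj_N: "adjoint_matrix N = block_matrix \<sigma> (\<lambda>_. K ** K)"
    by (simp add: N_def adjoint_block_matrix \<sigma>_inv adjoint_matrix_mult psd_matrix_adjoint[OF K(1)])
  have inv_block: "matrix_inv (K ** A k ** K) = K' ** matrix_inv (A k) ** K'" for k
  proof (rule matrix_inv_eqI)
    have "K ** A k ** K ** (K' ** matrix_inv (A k) ** K') = K ** (A k ** matrix_inv (A k)) ** K'"
      by (simp add: matrix_mul_assoc K'K_assoc)
    then show "K ** A k ** K ** (K' ** matrix_inv (A k) ** K') = mat 1"
      by (simp add: matrix_inv_right A KK')
  qed
  have inv_S: "matrix_inv S = block_matrix id (\<lambda>k. K' ** matrix_inv (A k) ** K')"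
    by (simp add: S_def matrix_inv_block_diagonal invertible_mult K A inv_block)
  have S: "psd_matrix S" "invertible S"
    unfolding S_def
    using psd_matrix_congruence[OF A(1), of K] psd_matrix_adjoint[OF K(1)]
    by (simp_all add: psd_block_diagonal invertible_block_diagonal invertible_mult K A)
  have N: "normal_matrix N"
    unfolding normal_matrix_def adj_N by (simp add: N_def block_matrix_mult \<sigma>_inv)
  have "N ** block_matrix \<sigma> (\<lambda>_. K' ** K') = mat 1"
    by (simp add: N_def block_matrix_mult \<sigma>_inv matrix_mul_assoc K'K_assoc KK' block_matrix_id)
  then have "invertible N"
    using invertible_right_inverse by blast

  have "geometric_mean S (adjoint_matrix N ** matrix_inv S ** N) = block_matrix id (\<lambda>k. K ** G k ** K)"
  proof (rule geometric_mean_eqI[OF S])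
    show "psd_matrix (block_matrix id (\<lambda>k. K ** G k ** K))"
      using psd_matrix_congruence[OF G(1), of K] psd_matrix_adjoint[OF K(1)]
      by (simp add: psd_block_diagonal)
    have "K ** G k ** K ** (K' ** matrix_inv (A k) ** K') ** (K ** G k ** K)
        = K ** (G k ** matrix_inv (A k) ** G k) ** K" for k
      by (simp add: matrix_mul_assoc K'K_assoc)
    \<comment> \<open>Both sides equal \<open>K ** matrix_inv (A (\<sigma> k)) ** K\<close>: the
      left by the Riccati equation for \<open>G k\<close>, the right by cancelling \<open>K\<close>
      against \<open>K'\<close>.\<close>
    then have block: "K ** G k ** K ** (K' ** matrix_inv (A k) ** K') ** (K ** G k ** K)
        = K ** K ** (K' ** matrix_inv (A (\<sigma> k)) ** K') ** (K ** K)" for k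
      by (simp add: G(2) matrix_mul_assoc K'K_assoc)
    show "block_matrix id (\<lambda>k. K ** G k ** K) ** matrix_inv S ** block_matrix id (\<lambda>k. K ** G k ** K)
        = adjoint_matrix N ** matrix_inv S ** N"
      unfolding adj_N inv_S by (simp add: N_def block_matrix_mult \<sigma>_inv block)
  qed
  then have "onorm ((*v) N) \<le> onorm ((*v) (block_matrix id (\<lambda>k. K ** G k ** K)))"
    using norm_bound[OF S N \<open>invertible N\<close>] by simp
  also have "\<dots> \<le> q + 3 * e * L"
  proof (rule onorm_block_diagonal_le)
    show "0 \<le> q + 3 * e * L"
      using \<open>0 \<le> q\<close> e(1) \<open>0 \<le> L\<close> by simp
    fix k y
    have "norm (K ** G k ** K *v y) \<le> (x \<bullet> (G k *v x) + 3 * e * L) * norm y"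
      unfolding K_def using unit G(1) L \<open>0 \<le> L\<close> e by (intro norm_near_compression_le) auto
    also have "\<dots> \<le> (q + 3 * e * L) * norm y"
      using q[of k] by (intro mult_right_mono) auto
    finally show "norm (K ** G k ** K *v y) \<le> (q + 3 * e * L) * norm y" .
  qed
  also have "\<dots> < 1"
    by (fact e(3))
  finally have "onorm ((*v) N) < 1" .

  \<comment> \<open>Permuting equal blocks changes nothing, so stacking copies of the eigenvector
    \<open>x\<close> of \<open>K\<close> gives an eigenvector of \<open>N\<close>.\<close>
  obtain z where z: "\<And>k. block k z = x"
    using block_surj[of "\<lambda>_. x"] by blast
  have "block k (N *v z) = block k (((1 + e) * (1 + e)) *\<^sub>R z)" for k
    by (simp add: N_def z Kx matrix_vector_mul_assoc[symmetric] matrix_vector_scaleR)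
      (simp add: block_def z[of k, symmetric] vec_eq_iff)
  then have "N *v z = ((1 + e) * (1 + e)) *\<^sub>R z"
    by (rule eq_if_blocks_eq)
  then have "(1 + e) * (1 + e) * norm z \<le> onorm ((*v) N) * norm z"
    using onorm[OF bounded_linear_matrix_vector, of N z] by simp
  moreover have "norm z > 0"
    using z unit by (auto simp: block_def zero_vec_def[symmetric])
  ultimately have "(1 + e) * (1 + e) \<le> onorm ((*v) N)"
    by simp
  moreover have "1 * 1 \<le> (1 + e) * (1 + e)"
    using e(1) by (intro mult_mono) auto
  ultimately show False
    using \<open>onorm ((*v) N) < 1\<close> by linarith
qed

end

section \<open>Rescaling and the arithmetic-geometric mean inequality\<close>

lemma matrix_inv_scaleR:
  fixes A :: "complex^'n^'n"
  assumes "invertible A" "c \<noteq> 0"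
  shows "matrix_inv (c *\<^sub>R A) = inverse c *\<^sub>R matrix_inv A"
  using assms
  by (intro matrix_inv_eqI) (simp add: scaleR_matrix_mult_left scaleR_matrix_mult_right matrix_inv_right)

text \<open>The scaled mean solves the scaled Riccati equation, since sqrt (c d)^2 / c = d.\<close>

lemma geometric_mean_scaleR:
  assumes X: "psd_matrix X" "invertible X" and Y: "psd_matrix Y" and c: "0 < c" and d: "0 \<le> d"
  shows "geometric_mean (c *\<^sub>R X) (d *\<^sub>R Y) = sqrt (c * d) *\<^sub>R geometric_mean X Y"
proof (rule geometric_mean_eqI)
  show "psd_matrix (c *\<^sub>R X)" "psd_matrix (sqrt (c * d) *\<^sub>R geometric_mean X Y)"
    using assms by (simp_all add: psd_matrix_scaleR psd_matrix_geometric_mean)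
  show "invertible (c *\<^sub>R X)"
    using X(2) c scalar_invertible[of c X] by simp
  have "sqrt (c * d) * (inverse c * sqrt (c * d)) = d"
    using c d by (simp add: field_simps)
  then show "(sqrt (c * d) *\<^sub>R geometric_mean X Y) ** matrix_inv (c *\<^sub>R X) ** (sqrt (c * d) *\<^sub>R geometric_mean X Y)
      = d *\<^sub>R Y"
    using c by (simp add: matrix_inv_scaleR X(2) scaleR_matrix_mult_left scaleR_matrix_mult_right
        geometric_mean_Riccati[OF X Y] mult_ac)
qed

text \<open>The rescaling that makes all three terms equal turns the bound on the maximum into one on the
  product. The shift \<open>d\<close> avoids a case distinction on vanishing \<open>p\<^sub>i\<close>.\<close>
lemma sum_ge_3_if_rescaled_max_ge_1:
  fixes p1 p2 p3 :: real
  assumes nonneg: "0 \<le> p1" "0 \<le> p2" "0 \<le> p3"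
    and max: "\<And>s1 s2. 0 < s1 \<Longrightarrow> 0 < s2 \<Longrightarrow> 1 \<le> s1 * p1 \<or> 1 \<le> s2 * p2 \<or> 1 \<le> p3 / (s1 * s2)"
  shows "3 \<le> p1 + p2 + p3"
proof (rule ccontr)
  assume less: "\<not> 3 \<le> p1 + p2 + p3"
  \<comment> \<open>The denominator 6 spends only half of the deficit: the three shifted numbers sum
    to 3 - 3 d, still below 3.\<close>
  define d where "d = (3 - (p1 + p2 + p3)) / 6"
  define r where "r p = root 3 (p + d)" for p
  have "d > 0"
    using less by (simp add: d_def)
  then have r: "0 < r p" "r p ^ 3 = p + d" if "0 \<le> p" for p
    using that by (simp_all add: r_def)
  note r = r[OF nonneg(1)] r[OF nonneg(2)] r[OF nonneg(3)]
  define t where "t = r p1 * r p2 * r p3"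
  have "0 < t"
    using r by (simp add: t_def)
  \<comment> \<open>The factorisation of a^3 + b^3 + c^3 - 3 a b c yields the mean inequality for
    the shifted numbers, with \<open>t\<close> as their geometric mean.\<close>
  have "r p1 ^ 3 + r p2 ^ 3 + r p3 ^ 3 - 3 * t =
      (r p1 + r p2 + r p3) * ((r p1 - r p2)\<^sup>2 + (r p2 - r p3)\<^sup>2 + (r p3 - r p1)\<^sup>2) / 2"
    by (simp add: t_def field_simps power2_eq_square power3_eq_cube)
  also have "\<dots> \<ge> 0"
    using r by simp
  finally have "3 * t \<le> p1 + p2 + p3 + 3 * d"
    using r by simp
  moreover have "6 * d = 3 - (p1 + p2 + p3)"
    by (simp add: d_def)
  ultimately have "t < 1"
    using less by linarith
  have small: "t / (p + d) * p < 1" if "0 \<le> p" for p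
  proof -
    have "t * p \<le> 1 * p"
      using \<open>t < 1\<close> that by (intro mult_right_mono) auto
    then show ?thesis
      using that \<open>d > 0\<close> by (simp add: divide_simps)
  qed
  \<comment> \<open>The factors t / (p_i + d) therefore have product 1, so the third one is the
    reciprocal of the product of the first two, as \<open>max\<close> requires.\<close>
  have "t ^ 3 = (p1 + d) * (p2 + d) * (p3 + d)"
    using r by (simp add: t_def power_mult_distrib)
  then have "p3 / (t / (p1 + d) * (t / (p2 + d))) = t / (p3 + d) * p3"
    using nonneg \<open>d > 0\<close> \<open>0 < t\<close> by (simp add: field_simps power3_eq_cube)
  then show False
    using max[of "t / (p1 + d)" "t / (p2 + d)"] small[OF nonneg(1)] small[OF nonneg(2)]
      small[OF nonneg(3)] nonneg \<open>d > 0\<close> \<open>0 < t\<close> by simp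
qed

theorem corollary2p2:
  fixes A B C :: "complex^'n^'n"
  assumes card_m: "CARD('m::finite) = 3 * CARD('n::finite)"
    and norm_bound: "\<forall>(S1 :: complex^'m^'m) (N :: complex^'m^'m).
      psd_matrix S1 \<and> invertible S1 \<and> normal_matrix N \<and> invertible N \<longrightarrow>
      onorm ((*v) (geometric_mean S1 (adjoint_matrix N ** matrix_inv S1 ** N))) \<ge> onorm ((*v) N)"
    and "psd_matrix A" "invertible A"
    and "psd_matrix B" "invertible B"
    and "psd_matrix C" "invertible C"
  shows "loewner_ge
      (geometric_mean A (matrix_inv B) + geometric_mean B (matrix_inv C)
        + geometric_mean C (matrix_inv A))
      (3 *\<^sub>R mat 1)"
proof -
  obtain \<phi> :: "'m \<Rightarrow> 3 \<times> 'n" where "block_indexing \<phi>"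
    using block_indexing_exists[where 'm = 'm and 'k = 3 and 'n = 'n] card_m by auto
  then interpret block_indexing \<phi> .
  define P where "P = geometric_mean A (matrix_inv B)"
  define Q where "Q = geometric_mean B (matrix_inv C)"
  define R where "R = geometric_mean C (matrix_inv A)"
  note PQR_def = P_def Q_def R_def
  have psd: "psd_matrix P" "psd_matrix Q" "psd_matrix R"
    using assms by (simp_all add: PQR_def psd_matrix_geometric_mean psd_matrix_matrix_inv)
  have scaled: "geometric_mean (c *\<^sub>R X) (matrix_inv (d *\<^sub>R Y)) = r *\<^sub>R geometric_mean X (matrix_inv Y)"
    if "psd_matrix X" "invertible X" "psd_matrix Y" "invertible Y" "c = r\<^sup>2 * d" "0 < r" "0 < d"
    for X Y :: "complex^'n^'n" and c d r
    using that
    by (simp add: matrix_inv_scaleR geometric_mean_scaleR psd_matrix_matrix_inv mult.assoc)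
  have unit: "3 \<le> x \<bullet> (P *v x) + x \<bullet> (Q *v x) + x \<bullet> (R *v x)" if "norm x = 1" for x
  proof (rule sum_ge_3_if_rescaled_max_ge_1)
    fix s1 s2 :: real
    assume s: "0 < s1" "0 < s2"
    \<comment> \<open>Consecutive weights have ratios s1^2, s2^2 and (s1 s2)^-2; the mean takes
      square roots of these ratios, which gives the factors s1, s2 and 1 / (s1 s2).\<close>
    define D :: "3 \<Rightarrow> complex^'n^'n" where
      "D k = (if k = 1 then A else if k = 2 then inverse (s1\<^sup>2) *\<^sub>R B else inverse ((s1 * s2)\<^sup>2) *\<^sub>R C)" for k
    define \<sigma> :: "3 \<Rightarrow> 3" where "\<sigma> k = (if k = 1 then 2 else if k = 2 then 3 else 1)" for k
    have D: "psd_matrix (D k)" "invertible (D k)" for k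
      using assms s by (auto simp: D_def psd_matrix_scaleR scalar_invertible)
    have "inj \<sigma>"
      by (auto simp: inj_def \<sigma>_def forall_3)
    then have "bij \<sigma>"
      by (simp add: bij_def finite_UNIV_inj_surj)
    have ratio: "1 = s1\<^sup>2 * inverse (s1\<^sup>2)" "inverse (s1\<^sup>2) = s2\<^sup>2 * inverse ((s1 * s2)\<^sup>2)"
      "inverse ((s1 * s2)\<^sup>2) = (inverse (s1 * s2))\<^sup>2 * 1"
      using s by (simp_all add: field_simps)
    obtain k where k: "1 \<le> x \<bullet> (geometric_mean (D k) (matrix_inv (D (\<sigma> k))) *v x)"
      using exists_inner_geometric_mean_ge_1[OF _ D \<open>bij \<sigma>\<close> \<open>norm x = 1\<close>] norm_bound by blast
    have g1: "geometric_mean (D 1) (matrix_inv (D (\<sigma> 1))) = s1 *\<^sub>R P"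
      using scaled[OF assms(3-6) ratio(1)] s by (simp add: D_def \<sigma>_def P_def)
    have g2: "geometric_mean (D 2) (matrix_inv (D (\<sigma> 2))) = s2 *\<^sub>R Q"
      using scaled[OF assms(5-8) ratio(2)] s by (simp add: D_def \<sigma>_def Q_def)
    have g3: "geometric_mean (D 3) (matrix_inv (D (\<sigma> 3))) = inverse (s1 * s2) *\<^sub>R R"
      using scaled[OF assms(7,8,3,4) ratio(3)] s by (simp add: D_def \<sigma>_def R_def)
    show "1 \<le> s1 * (x \<bullet> (P *v x)) \<or> 1 \<le> s2 * (x \<bullet> (Q *v x)) \<or> 1 \<le> x \<bullet> (R *v x) / (s1 * s2)"
      using exhaust_3[of k]
    proof (elim disjE)
      assume "k = 1"
      show ?thesis
        using k unfolding \<open>k = 1\<close> g1 by (simp add: scaleR_matrix_vector)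
    next
      assume "k = 2"
      show ?thesis
        using k unfolding \<open>k = 2\<close> g2 by (simp add: scaleR_matrix_vector)
    next
      assume "k = 3"
      show ?thesis
        using k unfolding \<open>k = 3\<close> g3 by (simp add: scaleR_matrix_vector divide_inverse mult_ac)
    qed
  qed (use psd psd_matrix_nonneg in blast)+
  have "psd_matrix (P + Q + R - 3 *\<^sub>R mat 1)"
  proof (rule psd_matrixI)
    fix x :: "complex^'n"
    show "0 \<le> x \<bullet> ((P + Q + R - 3 *\<^sub>R mat 1) *v x)"
    proof (cases "x = 0")
      case False
      \<comment> \<open>Both sides are homogeneous of degree 2 in \<open>x\<close>, so the
        unit-vector bound suffices.\<close>
      define u where "u = x /\<^sub>R norm x"
      have scale: "x \<bullet> (M *v x) = (norm x)\<^sup>2 * (u \<bullet> (M *v u))" for M :: "complex^'n^'n"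
        using False by (simp add: u_def matrix_vector_scaleR field_simps power2_eq_square)
      have "x \<bullet> ((P + Q + R - 3 *\<^sub>R mat 1) *v x)
          = x \<bullet> (P *v x) + x \<bullet> (Q *v x) + x \<bullet> (R *v x) - 3 * (norm x)\<^sup>2"
        by (simp add: matrix_vector_mult_diff_rdistrib matrix_vector_mult_add_rdistrib
            scaleR_matrix_vector inner_diff_right inner_add_right dot_square_norm)
      also have "\<dots> = (norm x)\<^sup>2 * (u \<bullet> (P *v u) + u \<bullet> (Q *v u) + u \<bullet> (R *v u) - 3)"
        unfolding scale[of P] scale[of Q] scale[of R] by (simp only: algebra_simps)
      also have "\<dots> \<ge> 0"
        using unit[of u] False by (simp add: u_def)
      finally show ?thesis .
    qed simp
  next
    show "adjoint_matrix (P + Q + R - 3 *\<^sub>R mat 1) = P + Q + R - 3 *\<^sub>R mat 1"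
      using psd by (intro hermitian_matrix_iff_inner[unfolded hermitian_matrix_def, THEN iffD2])
        (simp add: matrix_vector_mult_diff_rdistrib matrix_vector_mult_add_rdistrib scaleR_matrix_vector
          inner_diff inner_add psd_matrix_inner_commute)
  qed
  then show ?thesis
    by (simp add: loewner_ge_def PQR_def)
qed

end
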